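(* Let $T$ be an $\alpha$-averaged operator on a real Hilbert space $H$ with $\operatorname{Fix}T\ne\emptyset$ and $\alpha\in(0,1)$. Suppose $T$ is bounded Hölder regular. Let $(\lambda_t)_{t\in\mathbb{N}}$ be a sequence of real numbers with $\sigma_0:=\inf_{t\in\mathbb{N}}\{\lambda_t(1-\lambda_t)\}>0$ (where $\sigma_0\in(0,1)$). Given an initial point $x^0\in H$, set $$x^{t+1}=x^t+\lambda_t(T(x^t)-x^t)\qquad\forall t\in\mathbb{N}.$$ Then $x^t\to\bar x$ in norm for some $\bar x\in\operatorname{Fix}T$ at least with a sublinear rate $O(t^{-\rho})$ for some $\rho>0$. In particular, if $T$ is bounded Hölder regular with uniform exponent $\gamma\in(0,1]$, then there exist $M>0$ and $r\in[0,1)$ such that, for all $t\ge1$, $$\|x^t-\bar x\|\le\begin{cases}M\,t^{-\frac{\gamma}{2(1-\gamma)}},&\gamma\in(0,1),\\ M\,r^t,&\gamma=1.\end{cases}$$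
   Context: $\mathbb{N}=\{0,1,2,\dots\}$; $\operatorname{Fix}T=\{x\in H: T(x)=x\}$; $d(x,A)=\inf_{a\in A}\|x-a\|$. An operator $T:H\to H$ is $\alpha$-averaged, $\alpha\in(0,1)$, if $T=(1-\alpha)I+\alpha R$ for some nonexpansive $R:H\to H$. An operator $T:H\to H$ is bounded Hölder regular if for each bounded set $K\subseteq H$ there exist $\gamma\in(0,1]$ and $\mu>0$ such that $d(x,\operatorname{Fix}T)\le\mu\|x-T(x)\|^\gamma$ for all $x\in K$. If the exponent $\gamma$ can be chosen independently of $K$, $T$ is bounded Hölder regular with uniform exponent $\gamma$. Convergence with rate $O(t^{-\rho})$ means $\|x^t-\bar x\|\le Mt^{-\rho}$ for all $t\ge1$ and some constant $M$. *)

theory Defs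
  imports "HOL-Analysis.Analysis"
begin

definition Fix :: "('a \<Rightarrow> 'a) \<Rightarrow> 'a set" where
  "Fix T = {x. T x = x}"

definition nonexpansive :: "('a::real_normed_vector \<Rightarrow> 'a) \<Rightarrow> bool" where
  "nonexpansive R \<longleftrightarrow> 1-lipschitz_on UNIV R"

definition averaged :: "real \<Rightarrow> ('a::real_normed_vector \<Rightarrow> 'a) \<Rightarrow> bool" where
  "averaged \<alpha> T \<longleftrightarrow> 0 < \<alpha> \<and> \<alpha> < 1 \<and>
     (\<exists>R. nonexpansive R \<and> T = (\<lambda>x. (1 - \<alpha>) *\<^sub>R x + \<alpha> *\<^sub>R R x))"

text \<open>
  The distance to a set is \<open>infdist\<close>, which is \<open>0\<close> by convention if the set is empty; the
  definitions below are meant for operators with a fixed point.  Since \<open>0 powr \<gamma> = 0\<close>,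
  \<open>powr\<close> is the usual power \<open>s\<^sup>\<gamma>\<close> for all \<open>s \<ge> 0\<close> and \<open>\<gamma> > 0\<close>.
\<close>

definition bounded_Holder_regular :: "('a::real_normed_vector \<Rightarrow> 'a) \<Rightarrow> bool" where
  "bounded_Holder_regular T \<longleftrightarrow>
     (\<forall>K. bounded K \<longrightarrow>
        (\<exists>\<gamma> \<mu>. 0 < \<gamma> \<and> \<gamma> \<le> 1 \<and> 0 < \<mu> \<and>
          (\<forall>x\<in>K. infdist x (Fix T) \<le> \<mu> * norm (x - T x) powr \<gamma>)))"

definition bounded_Holder_regular_uniform ::
    "real \<Rightarrow> ('a::real_normed_vector \<Rightarrow> 'a) \<Rightarrow> bool" where
  "bounded_Holder_regular_uniform \<gamma> T \<longleftrightarrow> 0 < \<gamma> \<and> \<gamma> \<le> 1 \<and>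
     (\<forall>K. bounded K \<longrightarrow>
        (\<exists>\<mu>>0. \<forall>x\<in>K. infdist x (Fix T) \<le> \<mu> * norm (x - T x) powr \<gamma>))"

text \<open>The rate \<open>O(t\<^sup>-\<^sup>\<rho>)\<close>, with the bound required at every \<open>t \<ge> 1\<close>.\<close>

definition converges_with_rate ::
    "(nat \<Rightarrow> 'a::real_normed_vector) \<Rightarrow> 'a \<Rightarrow> real \<Rightarrow> bool" where
  "converges_with_rate x l \<rho> \<longleftrightarrow>
     (\<exists>M. \<forall>t\<ge>1. norm (x t - l) \<le> M * real t powr (- \<rho>))"

end

theory Submission
  imports Defs
begin

text \<open>
  With \<open>\<sigma> = (INF t. lam t * (1 - lam t))\<close>, every fixed point \<open>p\<close> satisfies
  \<open>(norm (x (Suc t) - p))\<^sup>2 \<le> (norm (x t - p))\<^sup>2 - \<sigma> * (norm (x t - T (x t)))\<^sup>2\<close>.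
  Taking the infimum over \<open>p\<close> and inserting Holder regularity on the bounded orbit, the squared
  distances \<open>s t\<close> of \<open>x t\<close> to the fixed point set satisfy \<open>s (Suc t) \<le> s t - c * s t powr (1/\<gamma>)\<close>,
  which determines their decay.  Fejer monotonicity bounds \<open>norm (x m - x t)\<close> by twice the distance
  of \<open>x t\<close> to the fixed point set for \<open>m \<ge> t\<close>, so the orbit is Cauchy and inherits the rate
  \<open>sqrt (s t)\<close>.
\<close>

section \<open>One step of the relaxed iteration\<close>

lemma averaged_imp_nonexpansive:
  assumes "averaged \<alpha> T"
  shows "nonexpansive T"
proof -
  obtain R where \<alpha>: "0 < \<alpha>" "\<alpha> < 1" and R: "1-lipschitz_on UNIV R"
    and T: "T = (\<lambda>x. (1 - \<alpha>) *\<^sub>R x + \<alpha> *\<^sub>R R x)"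
    using assms unfolding averaged_def nonexpansive_def by blast
  have "((1 - \<alpha>) * 1 + \<alpha> * 1)-lipschitz_on UNIV T"
    using lipschitz_on_add[OF lipschitz_on_cmult[OF lipschitz_on_id, of "1 - \<alpha>"]
        lipschitz_on_cmult[OF R, of \<alpha>]] \<alpha> T
    by simp
  then show ?thesis
    by (simp add: nonexpansive_def)
qed

lemma closed_Fix:
  assumes "nonexpansive T"
  shows "closed (Fix T)"
proof -
  have "continuous_on UNIV T"
    using assms lipschitz_on_continuous_on unfolding nonexpansive_def by blast
  then show ?thesis
    unfolding Fix_def by (intro closed_Collect_eq) auto
qed

text \<open>In an inner product space the squared norm of \<open>(1 - l) u + l v\<close> equals the
  affine combination of the squared norms minus \<open>l * (1 - l)\<close> times that of
  \<open>u - v\<close>. Nonexpansiveness gives \<open>norm v \<le> norm u\<close>, and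
  \<open>0 \<le> l\<close> lets this enter the identity.\<close>

lemma relaxed_nonexpansive_decrease:
  fixes T :: "'a::real_inner \<Rightarrow> 'a"
  assumes "nonexpansive T" and "p \<in> Fix T" and "0 \<le> l"
  shows "(norm (x + l *\<^sub>R (T x - x) - p))\<^sup>2 \<le> (norm (x - p))\<^sup>2 - l * (1 - l) * (norm (x - T x))\<^sup>2"
proof -
  define u v where "u = x - p" and "v = T x - p"
  have "dist (T x) (T p) \<le> 1 * dist x p"
    using assms(1) lipschitz_onD unfolding nonexpansive_def by blast
  then have "norm v \<le> norm u"
    using assms(2) by (simp add: Fix_def u_def v_def dist_norm)
  then have "l * (norm v)\<^sup>2 \<le> l * (norm u)\<^sup>2"
    using assms(3) by (intro mult_left_mono power_mono) auto
  moreover have "(norm (u + l *\<^sub>R (v - u)))\<^sup>2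
      = (1 - l) * (norm u)\<^sup>2 + l * (norm v)\<^sup>2 - l * (1 - l) * (norm (u - v))\<^sup>2"
    unfolding power2_norm_eq_inner
    by (simp add: inner_simps inner_commute algebra_simps power2_eq_square)
  moreover have "x + l *\<^sub>R (T x - x) - p = u + l *\<^sub>R (v - u)" "x - T x = u - v"
    by (simp_all add: u_def v_def algebra_simps)
  ultimately show ?thesis
    by (simp add: u_def algebra_simps)
qed

text \<open>The infimum need not be attained, so no nearest point is chosen. The \<open>sqrt\<close>
  term is free of \<open>p\<close> and lies below every \<open>dist x p\<close>, hence below their
  infimum.\<close>

lemma square_infdist_decrease:
  fixes x y :: "'a::real_normed_vector"
  assumes "F \<noteq> {}" and "\<And>p. p \<in> F \<Longrightarrow> (norm (y - p))\<^sup>2 \<le> (norm (x - p))\<^sup>2 - c"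
  shows "(infdist y F)\<^sup>2 \<le> (infdist x F)\<^sup>2 - c"
proof -
  have le: "sqrt ((infdist y F)\<^sup>2 + c) \<le> dist x p" if "p \<in> F" for p
  proof -
    have "infdist y F \<le> norm (y - p)"
      using infdist_le[OF that] by (simp add: dist_norm)
    then have "(infdist y F)\<^sup>2 \<le> (norm (y - p))\<^sup>2"
      by (simp add: power_mono infdist_nonneg)
    then have "(infdist y F)\<^sup>2 + c \<le> (dist x p)\<^sup>2"
      using assms(2)[OF that] by (simp add: dist_norm)
    then show ?thesis
      by (simp add: real_le_lsqrt)
  qed
  then have "sqrt ((infdist y F)\<^sup>2 + c) \<le> infdist x F"
    using assms(1) by (simp add: infdist_notempty cINF_greatest)
  then show ?thesis
    using sqrt_le_D by fastforce
qed

section \<open>Fejer monotone sequences in complete metric spaces\<close>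

lemma Fejer_convergence:
  fixes x :: "nat \<Rightarrow> 'a::complete_space"
  assumes F: "F \<noteq> {}" "closed F"
    and mono: "\<And>p t. p \<in> F \<Longrightarrow> dist (x (Suc t)) p \<le> dist (x t) p"
    and lim: "(\<lambda>t. infdist (x t) F) \<longlonglongrightarrow> 0"
  obtains l where "l \<in> F" "x \<longlonglongrightarrow> l" "\<And>t. dist (x t) l \<le> 2 * infdist (x t) F"
proof -
  have mono': "dist (x m) p \<le> dist (x t) p" if "p \<in> F" "t \<le> m" for p t m
    using lift_Suc_antimono_le[of "\<lambda>t. dist (x t) p"] mono that by blast
  have close: "dist (x t) (x m) \<le> 2 * infdist (x t) F" if "t \<le> m" for t m
  proof -
    have "dist (x t) (x m) / 2 \<le> dist (x t) p" if "p \<in> F" for p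
      using mono'[OF that \<open>t \<le> m\<close>] dist_triangle2[of "x t" "x m" p] by simp
    then have "dist (x t) (x m) / 2 \<le> infdist (x t) F"
      unfolding infdist_notempty[OF F(1)] using F(1) by (intro cINF_greatest)
    then show ?thesis by simp
  qed
  have "Cauchy x"
  proof (rule metric_CauchyI)
    fix e :: real assume "0 < e"
    then have "\<forall>\<^sub>F t in sequentially. infdist (x t) F < e / 4"
      using order_tendstoD(2)[OF lim, of "e / 4"] by simp
    then obtain N where N: "infdist (x N) F < e / 4"
      by (auto simp: eventually_sequentially)
    have "dist (x m) (x n) < e" if "N \<le> m" "N \<le> n" for m n
      using close[OF that(1)] close[OF that(2)] N dist_triangle3[of "x m" "x n" "x N"] by linarith
    then show "\<exists>N. \<forall>m\<ge>N. \<forall>n\<ge>N. dist (x m) (x n) < e"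
      by blast
  qed
  then obtain l where l: "x \<longlonglongrightarrow> l"
    using Cauchy_convergent convergent_def by blast
  have "(\<lambda>t. infdist (x t) F) \<longlonglongrightarrow> infdist l F"
    using l by (intro tendsto_intros)
  then have "infdist l F = 0"
    using lim LIMSEQ_unique by blast
  then have "l \<in> F"
    using F in_closed_iff_infdist_zero by blast
  \<comment> \<open>Letting \<open>m\<close> tend to infinity in \<open>close\<close> turns the
    Cauchy estimate into an error bound with the same constant.\<close>
  moreover have "dist (x t) l \<le> 2 * infdist (x t) F" for t
  proof (rule LIMSEQ_le_const2)
    show "(\<lambda>m. dist (x t) (x m)) \<longlonglongrightarrow> dist (x t) l"
      using l by (intro tendsto_intros)
    show "\<exists>N. \<forall>m\<ge>N. dist (x t) (x m) \<le> 2 * infdist (x t) F"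
      using close by blast
  qed
  ultimately show ?thesis
    using that l by blast
qed

section \<open>Decay of real sequences\<close>

text \<open>This is a discrete form of the differential equation with right-hand side
  \<open>- c * s powr (1 + a)\<close>, along whose positive solutions \<open>s powr (- a)\<close>
  grows at rate \<open>a * c\<close>. Here each step adds at least \<open>a * c\<close> while
  \<open>s\<close> stays positive.\<close>

lemma sublinear_decay:
  fixes s :: "nat \<Rightarrow> real"
  assumes nonneg: "\<And>t. 0 \<le> s t" and "0 < a" "0 < c"
    and step: "\<And>t. s (Suc t) \<le> s t - c * s t powr (1 + a)"
    and "1 \<le> t"
  shows "s t \<le> (a * c * real t) powr (- (1 / a))"
proof (cases "s t = 0")
  case False
  have *: "a * c * real t \<le> s t powr (- a)" if "0 < s t" for t
    using that
  proof (induction t)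
    case (Suc t)
    \<comment> \<open>Since \<open>s\<close> never increases, positivity passes back from
      \<open>Suc t\<close> to \<open>t\<close>, so the induction hypothesis applies.\<close>
    have pos: "0 < s t"
    proof -
      have "s (Suc t) \<le> s t"
        using step[of t] \<open>0 < c\<close> by (smt (verit) mult_nonneg_nonneg powr_ge_zero)
      with Suc.prems show ?thesis by simp
    qed
    define u where "u = c * s t powr a"
    have le: "s (Suc t) \<le> s t * (1 - u)"
      using step[of t] pos by (simp add: u_def powr_add algebra_simps)
    then have u: "0 < 1 - u"
      using Suc.prems pos by (smt (verit) mult_nonneg_nonpos)
    \<comment> \<open>Bernoulli's inequality for the exponent \<open>- a\<close>, from
      \<open>ln y \<le> y - 1\<close> and \<open>1 + z \<le> exp z\<close>.\<close>
    have "a * u \<le> - a * ln (1 - u)"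
      using mult_left_mono[OF ln_le_minus_one[OF u], of a] \<open>0 < a\<close> by simp
    then have "1 + a * u \<le> (1 - u) powr (- a)"
      using u exp_ge_add_one_self[of "- a * ln (1 - u)"] by (simp add: powr_def)
    then have "s t powr (- a) * (1 + a * u) \<le> s t powr (- a) * (1 - u) powr (- a)"
      by (intro mult_left_mono) auto
    also have "\<dots> = (s t * (1 - u)) powr (- a)"
      using pos u by (simp add: powr_mult)
    also have "\<dots> \<le> s (Suc t) powr (- a)"
      using le Suc.prems \<open>0 < a\<close> by (intro powr_mono2') auto
    also have "s t powr (- a) * (1 + a * u) = s t powr (- a) + a * c"
      using pos by (simp add: u_def powr_minus field_simps)
    finally show ?case
      using Suc.IH[OF pos] by (simp add: algebra_simps)
  qed simp
  have pos: "0 < s t"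
    using False nonneg[of t] by simp
  have "(s t powr (- a)) powr (- (1 / a)) \<le> (a * c * real t) powr (- (1 / a))"
    using *[OF pos] assms by (intro powr_mono2') auto
  then show ?thesis
    using pos \<open>0 < a\<close> by (simp add: powr_powr)
qed simp

lemma linear_decay:
  fixes s :: "nat \<Rightarrow> real"
  assumes nonneg: "\<And>t. 0 \<le> s t" and step: "\<And>t. s (Suc t) \<le> q * s t" and "0 \<le> q"
  shows "s t \<le> q ^ t * s 0"
proof (induction t)
  case (Suc t)
  have "s (Suc t) \<le> q * (q ^ t * s 0)"
    using step[of t] mult_left_mono[OF Suc.IH \<open>0 \<le> q\<close>] by simp
  then show ?case by (simp add: mult.assoc)
qed simp

lemma Holder_decay:
  fixes d e :: "nat \<Rightarrow> real"
  assumes nonneg: "\<And>t. 0 \<le> d t" "\<And>t. 0 \<le> e t"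
    and "0 < \<sigma>" "0 < \<mu>" "0 < \<gamma>" "\<gamma> \<le> 1"
    and step: "\<And>t. (d (Suc t))\<^sup>2 \<le> (d t)\<^sup>2 - \<sigma> * (e t)\<^sup>2"
    and Holder: "\<And>t. d t \<le> \<mu> * e t powr \<gamma>"
  obtains M r where "0 < M" "0 \<le> r" "r < 1"
    and "\<And>t. 1 \<le> t \<Longrightarrow>
      d t \<le> (if \<gamma> < 1 then M * real t powr (- (\<gamma> / (2 * (1 - \<gamma>)))) else M * r ^ t)"
proof -
  define s where "s t = (d t)\<^sup>2" for t
  \<comment> \<open>Inverting the Holder bound gives
    \<open>(d t / \<mu>) powr (2 / \<gamma>) \<le> (e t)\<^sup>2\<close>; the factor
    \<open>\<sigma>\<close> comes from \<open>step\<close>.\<close>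
  define c where "c = \<sigma> * (1 / \<mu>) powr (2 / \<gamma>)"
  have "0 < c"
    using assms by (simp add: c_def)
  have d: "d t = sqrt (s t)" for t
    using nonneg by (simp add: s_def)
  have s: "s (Suc t) \<le> s t - c * s t powr (1 / \<gamma>)" for t
  proof -
    have "d t / \<mu> \<le> e t powr \<gamma>"
      using Holder[of t] \<open>0 < \<mu>\<close> by (simp add: field_simps)
    then have "(d t / \<mu>) powr (2 / \<gamma>) \<le> (e t powr \<gamma>) powr (2 / \<gamma>)"
      using assms nonneg by (intro powr_mono2) auto
    also have "\<dots> = (e t)\<^sup>2"
      using nonneg(2)[of t] \<open>0 < \<gamma>\<close> by (simp add: powr_powr)
    also have "(d t / \<mu>) powr (2 / \<gamma>) = (1 / \<mu>) powr (2 / \<gamma>) * (d t powr 2) powr (1 / \<gamma>)"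
      using nonneg(1)[of t] \<open>0 < \<mu>\<close> by (simp add: powr_divide powr_powr del: powr_numeral)
    also have "d t powr 2 = s t"
      using nonneg(1)[of t] by (simp add: s_def)
    finally have "c * s t powr (1 / \<gamma>) \<le> \<sigma> * (e t)\<^sup>2"
      using \<open>0 < \<sigma>\<close> by (simp add: c_def mult.assoc)
    then show ?thesis
      using step[of t] by (simp add: s_def)
  qed
  show ?thesis
  proof (cases "\<gamma> < 1")
    case True
    \<comment> \<open>Chosen so that \<open>1 + a = 1 / \<gamma>\<close>; it is positive exactly
      when \<open>\<gamma> < 1\<close>.\<close>
    define a where "a = 1 / \<gamma> - 1"
    have "0 < a"
      using True \<open>0 < \<gamma>\<close> by (simp add: a_def field_simps)
    have a: "1 / a = \<gamma> / (1 - \<gamma>)"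
      using True \<open>0 < \<gamma>\<close> by (simp add: a_def field_simps)
    \<comment> \<open>Half of the exponent \<open>- (1 / a)\<close>, because \<open>d\<close> is the
      square root of \<open>s\<close>.\<close>
    define b where "b = - (\<gamma> / (2 * (1 - \<gamma>)))"
    have b: "- (1 / a) / 2 = b"
      unfolding a b_def using True by (simp add: field_simps)
    have "d t \<le> (a * c) powr b * real t powr b" if "1 \<le> t" for t
    proof -
      have "d t \<le> sqrt ((a * c * real t) powr (- (1 / a)))"
        unfolding d real_sqrt_le_iff using s \<open>0 < a\<close> \<open>0 < c\<close> that
        by (intro sublinear_decay) (auto simp: a_def s_def)
      also have "\<dots> = (a * c * real t) powr b"
        by (simp only: b[symmetric] powr_half_sqrt[symmetric] powr_ge_zero powr_powr) simp
      also have "\<dots> = (a * c) powr b * real t powr b"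
        using \<open>0 < a\<close> \<open>0 < c\<close> by (simp add: powr_mult)
      finally show ?thesis .
    qed
    \<comment> \<open>The bound for \<open>\<gamma> < 1\<close> does not mention \<open>r\<close>,
      so \<open>0\<close> serves as the witness.\<close>
    then show ?thesis
      using that[of "(a * c) powr b" 0] True \<open>0 < a\<close> \<open>0 < c\<close> by (simp add: b_def)
  next
    case False
    then have "\<gamma> = 1"
      using \<open>\<gamma> \<le> 1\<close> by simp
    \<comment> \<open>The maximum covers \<open>c > 1\<close>, where \<open>1 - c\<close> is
      negative and could not serve as a ratio.\<close>
    define q where "q = max 0 (1 - c)"
    have q: "0 \<le> q" "q < 1"
      using \<open>0 < c\<close> by (auto simp: q_def)
    have "s (Suc t) \<le> q * s t" for t
    proof -
      have "s (Suc t) \<le> (1 - c) * s t"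
        using s[of t] \<open>\<gamma> = 1\<close> by (simp add: s_def algebra_simps)
      also have "\<dots> \<le> q * s t"
        by (intro mult_right_mono) (auto simp: q_def s_def)
      finally show ?thesis .
    qed
    then have st: "s t \<le> q ^ t * s 0" for t
      using linear_decay[of s q t] q by (simp add: s_def)
    \<comment> \<open>The added \<open>1\<close> keeps the constant positive even if
      \<open>d 0 = 0\<close>.\<close>
    have "d t \<le> (d 0 + 1) * sqrt q ^ t" for t
    proof -
      have "d t \<le> sqrt q ^ t * d 0"
        using st[of t] unfolding d by (metis real_sqrt_le_iff real_sqrt_mult real_sqrt_power)
      also have "\<dots> \<le> (d 0 + 1) * sqrt q ^ t"
        using q by (simp add: algebra_simps)
      finally show ?thesis .
    qed
    then show ?thesis
      using that[of "d 0 + 1" "sqrt q"] q False nonneg(1)[of 0] by simp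
  qed
qed

text \<open>Converts the linear rate of the case \<open>\<gamma> = 1\<close> into a power rate:
  \<open>n * r ^ n\<close> tends to \<open>0\<close>, hence is bounded.\<close>

lemma geometric_le_harmonic:
  fixes r :: real
  assumes "0 \<le> r" "r < 1"
  obtains K where "0 < K" "\<And>t. 1 \<le> t \<Longrightarrow> r ^ t \<le> K * real t powr - 1"
proof -
  have "(\<lambda>n. of_nat n * r ^ n) \<longlonglongrightarrow> 0"
    using assms by (intro powser_times_n_limit_0) auto
  then have "Bseq (\<lambda>n. real n * r ^ n)"
    using convergentI convergent_imp_Bseq by fastforce
  then obtain K where K: "0 < K" "\<And>n. norm (real n * r ^ n) \<le> K"
    by (auto elim: BseqE)
  have "r ^ t \<le> K * real t powr - 1" if "1 \<le> t" for t
    using K(2)[of t] assms that by (simp add: powr_minus field_simps abs_mult)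
  with K(1) that show ?thesis by blast
qed

section \<open>Convergence and rates of the relaxed iteration\<close>

theorem corollary3p9:
  fixes T :: "'a::{real_inner, complete_space} \<Rightarrow> 'a"
    and \<alpha> :: real
    and lam :: "nat \<Rightarrow> real"
    and x :: "nat \<Rightarrow> 'a"
    and x0 :: 'a
  assumes "0 < \<alpha>" and "\<alpha> < 1"
    and "averaged \<alpha> T"
    and "Fix T \<noteq> {}"
    and "bounded_Holder_regular T"
    and "bdd_below (range (\<lambda>t. lam t * (1 - lam t)))"
    and "(INF t. lam t * (1 - lam t)) > 0"
    and "x 0 = x0"
    and "\<And>t. x (Suc t) = x t + lam t *\<^sub>R (T (x t) - x t)"
  shows "\<exists>xbar\<in>Fix T.
           x \<longlonglongrightarrow> xbar \<and>
           (\<exists>\<rho>>0. converges_with_rate x xbar \<rho>) \<and>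
           (\<forall>\<gamma>. bounded_Holder_regular_uniform \<gamma> T \<longrightarrow>
              (\<exists>M>0. \<exists>r. 0 \<le> r \<and> r < 1 \<and>
                 (\<forall>t\<ge>1. norm (x t - xbar) \<le>
                    (if \<gamma> < 1 then M * real t powr (- (\<gamma> / (2 * (1 - \<gamma>))))
                     else M * r ^ t))))"
proof -
  define \<sigma> where "\<sigma> = (INF t. lam t * (1 - lam t))"
  have "0 < \<sigma>"
    using assms(7) by (simp add: \<sigma>_def)
  have \<sigma>: "\<sigma> \<le> lam t * (1 - lam t)" for t
    unfolding \<sigma>_def using assms(6) by (rule cINF_lower) simp
  \<comment> \<open>A negative \<open>lam t\<close> would make \<open>lam t * (1 - lam t)\<close>
    negative, against \<open>\<sigma> > 0\<close>.\<close>
  have lam: "0 \<le> lam t" for t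
    using \<sigma>[of t] \<open>0 < \<sigma>\<close> by (smt (verit) mult_nonpos_nonneg)
  have T: "nonexpansive T"
    using assms(3) by (rule averaged_imp_nonexpansive)
  have decrease: "(norm (x (Suc t) - p))\<^sup>2 \<le> (norm (x t - p))\<^sup>2 - \<sigma> * (norm (x t - T (x t)))\<^sup>2"
    if "p \<in> Fix T" for p t
    using relaxed_nonexpansive_decrease[OF T that lam[of t], of "x t"] assms(9)[of t]
      mult_right_mono[OF \<sigma>[of t], of "(norm (x t - T (x t)))\<^sup>2"]
    by simp
  have mono: "dist (x (Suc t)) p \<le> dist (x t) p" if "p \<in> Fix T" for p t
  proof -
    have "(norm (x (Suc t) - p))\<^sup>2 \<le> (norm (x t - p))\<^sup>2"
      using decrease[OF that, of t] \<open>0 < \<sigma>\<close> by (smt (verit) mult_nonneg_nonneg zero_le_power2)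
    then show ?thesis
      by (simp add: dist_norm)
  qed
  obtain p where p: "p \<in> Fix T"
    using assms(4) by blast
  have "dist (x t) p \<le> dist (x 0) p" for t
    using lift_Suc_antimono_le[of "\<lambda>t. dist (x t) p" 0 t] mono[OF p] by blast
  then have bounded: "bounded (range x)"
    unfolding bounded_def by (metis dist_commute rangeE)
  define d where "d t = infdist (x t) (Fix T)" for t
  have step: "(d (Suc t))\<^sup>2 \<le> (d t)\<^sup>2 - \<sigma> * (norm (x t - T (x t)))\<^sup>2" for t
    unfolding d_def using assms(4) decrease by (rule square_infdist_decrease)
  \<comment> \<open>Regularity is required only on the orbit, for arbitrary \<open>\<gamma>\<close>
    and \<open>\<mu>\<close>, so this serves both the exponent attached to the orbit and every
    uniform exponent.\<close>
  have rate: "\<exists>M>0. \<exists>r. 0 \<le> r \<and> r < 1 \<and> (\<forall>t\<ge>1.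
      d t \<le> (if \<gamma> < 1 then M * real t powr (- (\<gamma> / (2 * (1 - \<gamma>)))) else M * r ^ t))"
    if bounds: "0 < \<gamma>" "\<gamma> \<le> 1" "0 < \<mu>"
      and Holder: "\<forall>y\<in>range x. infdist y (Fix T) \<le> \<mu> * norm (y - T y) powr \<gamma>" for \<gamma> \<mu>
  proof -
    have "d t \<le> \<mu> * norm (x t - T (x t)) powr \<gamma>" for t
      using Holder by (simp add: d_def)
    moreover have "0 \<le> d t" for t
      by (simp add: d_def infdist_nonneg)
    ultimately obtain M r where "0 < M" "0 \<le> r" "r < 1" "\<And>t. 1 \<le> t \<Longrightarrow>
        d t \<le> (if \<gamma> < 1 then M * real t powr (- (\<gamma> / (2 * (1 - \<gamma>)))) else M * r ^ t)"
      using Holder_decay[of d "\<lambda>t. norm (x t - T (x t))" \<sigma> \<mu> \<gamma>] bounds \<open>0 < \<sigma>\<close> step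
      by (metis norm_ge_zero)
    then show ?thesis
      by blast
  qed
  obtain \<rho> C where \<rho>: "0 < \<rho>" and C: "\<And>t. 1 \<le> t \<Longrightarrow> d t \<le> C * real t powr (- \<rho>)"
  proof -
    obtain \<gamma> \<mu> where \<gamma>: "0 < \<gamma>" "\<gamma> \<le> 1" "0 < \<mu>"
      "\<forall>y\<in>range x. infdist y (Fix T) \<le> \<mu> * norm (y - T y) powr \<gamma>"
      using assms(5) bounded unfolding bounded_Holder_regular_def by blast
    obtain M r where M: "0 < M" "0 \<le> r" "r < 1" "\<forall>t\<ge>1.
        d t \<le> (if \<gamma> < 1 then M * real t powr (- (\<gamma> / (2 * (1 - \<gamma>)))) else M * r ^ t)"
      using rate[OF \<gamma>] by blast
    show ?thesis
    proof (cases "\<gamma> < 1")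
      case True
      then show ?thesis
        using that[of "\<gamma> / (2 * (1 - \<gamma>))" M] M \<gamma> by simp
    next
      \<comment> \<open>Here \<open>\<gamma> = 1\<close> and the decay is geometric; the exponent
        \<open>\<rho> = 1\<close> is one convenient choice.\<close>
      case False
      obtain K where K: "\<And>t. 1 \<le> t \<Longrightarrow> r ^ t \<le> K * real t powr - 1"
        using geometric_le_harmonic M(2,3) by blast
      have "d t \<le> M * K * real t powr - 1" if "1 \<le> t" for t
      proof -
        have "d t \<le> M * r ^ t"
          using M(4) that False by simp
        also have "\<dots> \<le> M * (K * real t powr - 1)"
          using K[OF that] M(1) by (intro mult_left_mono) auto
        finally show ?thesis by (simp only: mult.assoc)
      qed
      then show ?thesis
        using that[of 1 "M * K"] by simp
    qed
  qed
  have "(\<lambda>t. real t powr (- \<rho>)) \<longlonglongrightarrow> 0"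
    using \<rho> by (intro tendsto_neg_powr filterlim_real_sequentially) simp
  then have "(\<lambda>t. C * real t powr (- \<rho>)) \<longlonglongrightarrow> 0"
    by (rule tendsto_mult_right_zero)
  then have lim: "d \<longlonglongrightarrow> 0"
    by (rule tendsto_sandwich[rotated 3, OF _ _ _ tendsto_const])
      (use C in \<open>auto simp: eventually_sequentially d_def infdist_nonneg\<close>)
  \<comment> \<open>The limit is fixed before any uniform exponent is considered, so the same
    \<open>l\<close> works for all of them.\<close>
  obtain l where l: "l \<in> Fix T" "x \<longlonglongrightarrow> l" and "\<And>t. dist (x t) l \<le> 2 * infdist (x t) (Fix T)"
    using Fejer_convergence[of "Fix T" x] assms(4) closed_Fix[OF T] mono lim
    unfolding d_def by blast
  then have le: "norm (x t - l) \<le> 2 * d t" for t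
    by (simp add: d_def dist_norm)
  have "norm (x t - l) \<le> 2 * C * real t powr (- \<rho>)" if "1 \<le> t" for t
    using le[of t] C[OF that] by simp
  then have "converges_with_rate x l \<rho>"
    unfolding converges_with_rate_def by blast
  moreover have "\<exists>M>0. \<exists>r. 0 \<le> r \<and> r < 1 \<and> (\<forall>t\<ge>1. norm (x t - l) \<le>
      (if \<gamma> < 1 then M * real t powr (- (\<gamma> / (2 * (1 - \<gamma>)))) else M * r ^ t))"
    if reg: "bounded_Holder_regular_uniform \<gamma> T" for \<gamma>
  proof -
    obtain \<mu> where "0 < \<gamma>" "\<gamma> \<le> 1" "0 < \<mu>"
      "\<forall>y\<in>range x. infdist y (Fix T) \<le> \<mu> * norm (y - T y) powr \<gamma>"
      using reg bounded unfolding bounded_Holder_regular_uniform_def by blast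
    from rate[OF this] obtain M r where M: "0 < M" "0 \<le> r" "r < 1" "\<forall>t\<ge>1.
        d t \<le> (if \<gamma> < 1 then M * real t powr (- (\<gamma> / (2 * (1 - \<gamma>)))) else M * r ^ t)"
      by blast
    have "norm (x t - l) \<le>
        (if \<gamma> < 1 then 2 * M * real t powr (- (\<gamma> / (2 * (1 - \<gamma>)))) else 2 * M * r ^ t)"
      if "1 \<le> t" for t
      using le[of t] M(4)[rule_format, OF that] by (auto split: if_splits)
    then show ?thesis
      using M(1-3) by (intro exI[of _ "2 * M"] conjI exI[of _ r]) auto
  qed
  ultimately show ?thesis
    using l \<rho> by blast
qed

end
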